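(* Let $\mathcal{R}=\mathbb{F}_{q_1}\oplus\cdots\oplus\mathbb{F}_{q_r}$ with $r\ge1$, and let $k\ge1$. There exists a sequence $\mathbf{a}$ over $\mathcal{R}$ satisfying a linear recurrence of degree $k$ over $\mathcal{R}$ (with $c_0$ a unit) with $\rho(\mathbf{a})=|\mathcal{R}|^k-1$ if and only if $r=1$, i.e. $\mathcal{R}$ is a field.
   Context: $q_1,\dots,q_r$ are prime powers (not necessarily of the same characteristic), so $|\mathcal{R}|=q_1\cdots q_r$. A sequence $(a_n)_{n\ge0}$ over $\mathcal{R}$ satisfies a linear recurrence of degree $k$ if there are $c_0,\dots,c_{k-1}\in\mathcal{R}$ with $c_0$ a unit such that $a_{n+k}=\sum_{i=0}^{k-1}c_ia_{n+i}$ for all $n\ge0$; such sequences are purely periodic, and $\rho(\mathbf{a})$ is the least $m>0$ with $a_{n+m}=a_n$ for all $n\ge0$. *)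

theory Defs
  imports "HOL-Algebra.Chinese_Remainder"
begin

definition lin_rec :: "('a, 'm) ring_scheme \<Rightarrow> nat \<Rightarrow> (nat \<Rightarrow> 'a) \<Rightarrow> (nat \<Rightarrow> 'a) \<Rightarrow> bool" where
  "lin_rec R k c a \<longleftrightarrow>
     (\<forall>n. a n \<in> carrier R) \<and>
     (\<forall>i<k. c i \<in> carrier R) \<and>
     c 0 \<in> Units R \<and>
     (\<forall>n. a (n + k) = finsum R (\<lambda>i. c i \<otimes>\<^bsub>R\<^esub> a (n + i)) {..<k})"

definition least_period :: "(nat \<Rightarrow> 'a) \<Rightarrow> nat" where
  "least_period a = (LEAST m. 0 < m \<and> (\<forall>n. a (n + m) = a n))"

end

theory Submission
  imports Defs "HOL-Algebra.Algebraic_Closure" "HOL-Algebra.Sylow"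
begin

text \<open>
  Over a finite ring \<open>A\<close> with at least two elements, the window of \<open>k\<close> consecutive terms determines
  a recurring sequence in both directions, and the zero window only occurs in the zero sequence; so
  the period is at most \<open>|A|\<^sup>k - 1\<close>. Writing \<open>R = F \<times> G\<close> with both factors nontrivial, the product of
  the two component periods is a period and is at most \<open>(|F|\<^sup>k - 1)(|G|\<^sup>k - 1) < |R|\<^sup>k - 1\<close>.

  Conversely, over a field \<open>F\<close> with \<open>q\<close> elements let \<open>K\<close> be the field of fixed points of
  \<open>x \<mapsto> x\<^bsup>N\<^esup>\<close>, \<open>N = q\<^sup>k\<close>, in the algebraic closure, and \<open>\<alpha>\<close> a generator of its multiplicative
  group. The powers \<open>1, \<alpha>, \<dots>, \<alpha>\<^bsup>k-1\<^esup>\<close> are a basis of \<open>K\<close> over \<open>F\<close>; the recurrence is read off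
  from the expansion of \<open>\<alpha>\<^sup>k\<close>, and the coordinate of \<open>\<alpha>\<^sup>n\<close> at \<open>1\<close> is a sequence of period \<open>N - 1\<close>.
\<close>

subsection \<open>Periods of linear recurring sequences\<close>

text \<open>Homomorphisms carry units to units and commute with finite sums. This serves for the
  projections of a product ring and for the map sending \<open>x\<close> to
  \<open>[x]\<close>.\<close>

lemma (in ring_hom_ring) lin_rec_hom:
  assumes "lin_rec R k c a"
  shows "lin_rec S k (\<lambda>i. h (c i)) (\<lambda>n. h (a n))"
proof -
  have a: "\<And>n. a n \<in> carrier R" and c: "\<And>i. i < k \<Longrightarrow> c i \<in> carrier R"
    and u: "c 0 \<in> Units R"
    and rec: "\<And>n. a (n + k) = finsum R (\<lambda>i. c i \<otimes>\<^bsub>R\<^esub> a (n + i)) {..<k}"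
    using assms unfolding lin_rec_def by auto
  have "h (c 0) \<in> Units S"
  proof -
    from u obtain d where d: "d \<in> carrier R" "d \<otimes>\<^bsub>R\<^esub> c 0 = \<one>\<^bsub>R\<^esub>" "c 0 \<otimes>\<^bsub>R\<^esub> d = \<one>\<^bsub>R\<^esub>"
      and c0: "c 0 \<in> carrier R"
      unfolding Units_def by blast
    then have "h d \<otimes>\<^bsub>S\<^esub> h (c 0) = \<one>\<^bsub>S\<^esub>" "h (c 0) \<otimes>\<^bsub>S\<^esub> h d = \<one>\<^bsub>S\<^esub>"
      by (metis hom_mult hom_one)+
    then show ?thesis
      using d(1) c0 unfolding Units_def by auto
  qed
  moreover have "h (a (n + k)) = finsum S (\<lambda>i. h (c i) \<otimes>\<^bsub>S\<^esub> h (a (n + i))) {..<k}" for n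
  proof -
    have "h (a (n + k)) = finsum S (h \<circ> (\<lambda>i. c i \<otimes>\<^bsub>R\<^esub> a (n + i))) {..<k}"
      unfolding rec by (rule hom_finsum) (use a c in auto)
    also have "\<dots> = finsum S (\<lambda>i. h (c i) \<otimes>\<^bsub>S\<^esub> h (a (n + i))) {..<k}"
      by (rule S.finsum_cong') (use a c in auto)
    finally show ?thesis .
  qed
  ultimately show ?thesis
    using a c unfolding lin_rec_def by auto
qed

text \<open>Equal windows stay equal later on by the recurrence itself. They were also equal before,
  because the unit \<open>c 0\<close> lets the recurrence be solved for its oldest term. So a
  repetition reaches back to index 0 and periodicity is pure.\<close>

lemma (in ring) lin_rec_repeated_state_imp_period:
  assumes lr: "lin_rec R k c a" and "k \<ge> 1" and "i < j"
    and state: "\<And>t. t < k \<Longrightarrow> a (i + t) = a (j + t)"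
  shows "a (n + (j - i)) = a n"
proof -
  define m where "m = j - i"
  have a: "\<And>n. a n \<in> carrier R" and c: "\<And>i. i < k \<Longrightarrow> c i \<in> carrier R"
    and u: "c 0 \<in> Units R"
    and rec: "\<And>n. a (n + k) = (\<Oplus>i\<in>{..<k}. c i \<otimes> a (n + i))"
    using lr unfolding lin_rec_def by auto
  have rec_split: "a (n + k) = c 0 \<otimes> a n \<oplus> (\<Oplus>i\<in>{0<..<k}. c i \<otimes> a (n + i))" for n
  proof -
    have "{..<k} = insert 0 {0<..<k}" using \<open>k \<ge> 1\<close> by auto
    then show ?thesis
      unfolding rec using a c u by (subst \<open>{..<k} = _\<close>, subst finsum_insert) auto
  qed
  have forward: "a (i + t + m) = a (i + t)" for t
  proof (induction t rule: less_induct)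
    case (less t)
    show ?case
    proof (cases "t < k")
      case True
      then show ?thesis using state[of t] \<open>i < j\<close> by (simp add: m_def add_ac)
    next
      case False
      \<comment> \<open>The term at \<open>i + t\<close> is computed from the window starting at
        \<open>s\<close>, all of whose entries the induction hypothesis covers.\<close>
      define s where "s = i + (t - k)"
      have "(\<Oplus>l\<in>{..<k}. c l \<otimes> a (s + m + l)) = (\<Oplus>l\<in>{..<k}. c l \<otimes> a (s + l))"
      proof (rule finsum_cong')
        fix l assume "l \<in> {..<k}"
        then have "a (i + (t - k + l) + m) = a (i + (t - k + l))"
          using False by (intro less.IH) auto
        then show "c l \<otimes> a (s + m + l) = c l \<otimes> a (s + l)"
          by (simp add: s_def add_ac)
      qed (use a c in auto)
      then have "a (s + m + k) = a (s + k)" unfolding rec .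
      then show ?thesis using False by (simp add: s_def add_ac)
    qed
  qed
  \<comment> \<open>Each step in \<open>d\<close> lowers the starting index by one; truncated
    subtraction lets \<open>d = i\<close> cover every \<open>n\<close>.\<close>
  have backward: "\<forall>n \<ge> i - d. a (n + m) = a n" for d
  proof (induction d)
    case 0
    show ?case using forward by (metis diff_zero le_add_diff_inverse)
  next
    case (Suc d)
    show ?case
    proof (intro allI impI)
      fix n assume n: "n \<ge> i - Suc d"
      show "a (n + m) = a n"
      proof (cases "n \<ge> i - d")
        case True
        then show ?thesis using Suc by blast
      next
        case False
        then have later: "a (n + l + m) = a (n + l)" if "l > 0" for l
          using Suc n that by simp
        \<comment> \<open>\<open>r\<close> collects all of the recurrence at \<open>n\<close> except
          the \<open>c 0\<close> term. It is invariant under the shift by \<open>m\<close>, so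
          \<open>r\<close> and then the unit \<open>c 0\<close> can be cancelled.\<close>
        define r where "r = (\<Oplus>l\<in>{0<..<k}. c l \<otimes> a (n + l))"
        have r: "r \<in> carrier R"
          unfolding r_def using a c by (intro finsum_closed) auto
        have "(\<Oplus>l\<in>{0<..<k}. c l \<otimes> a (n + m + l)) = r"
          unfolding r_def using later a c by (intro finsum_cong') (auto simp: add_ac)
        then have "c 0 \<otimes> a (n + m) \<oplus> r = c 0 \<otimes> a n \<oplus> r"
          using rec_split[of n] rec_split[of "n + m"] later[of k] \<open>k \<ge> 1\<close>
          by (simp add: r_def add_ac)
        then have "c 0 \<otimes> a (n + m) = c 0 \<otimes> a n"
          using r u a Units_closed by simp
        then show ?thesis using u a Units_l_cancel by blast
      qed
    qed
  qed
  show ?thesis using backward[of i] by (simp add: m_def)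
qed

text \<open>Pigeonhole on windows of length \<open>k\<close>: without the zero window only |R|^k - 1
  of them remain. If the zero window does occur, 1 is a period, and it obeys the bound because |R|^k
  is at least 2.\<close>

lemma (in ring) lin_rec_ex_period:
  assumes lr: "lin_rec R k c a" and k: "k \<ge> 1"
    and fin: "finite (carrier R)" and nontriv: "card (carrier R) \<ge> 2"
  shows "\<exists>m. 0 < m \<and> m \<le> card (carrier R) ^ k - 1 \<and> (\<forall>n. a (n + m) = a n)"
proof -
  let ?N = "card (carrier R) ^ k"
  have a: "\<And>n. a n \<in> carrier R" and c: "\<And>i. i < k \<Longrightarrow> c i \<in> carrier R"
    and rec: "\<And>n. a (n + k) = (\<Oplus>i\<in>{..<k}. c i \<otimes> a (n + i))"
    using lr unfolding lin_rec_def by auto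
  have N: "2 \<le> ?N"
    using nontriv k self_le_power[of "card (carrier R)" k] by linarith
  \<comment> \<open>Windows are restricted functions, so they lie in an extensional function space
    with exactly \<open>?N\<close> elements.\<close>
  define s where "s n = (\<lambda>i\<in>{..<k}. a (n + i))" for n
  define z where "z = (\<lambda>i\<in>{..<k}. \<zero>)"
  have s_eqD: "a (i + t) = a (j + t)" if "s i = s j" "t < k" for i j t
    using fun_cong[OF that(1), of t] that(2) by (simp add: s_def)
  show ?thesis
  proof (cases "\<exists>n. s n = z")
    case True
    then obtain n where "s n = z" by blast
    have zero: "a (n + i) = \<zero>" if "i < k" for i
      using fun_cong[OF \<open>s n = z\<close>, of i] that by (simp add: s_def z_def)
    have "(\<Oplus>i\<in>{..<k}. c i \<otimes> a (n + i)) = (\<Oplus>i\<in>{..<k}. \<zero>)"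
      using zero c by (intro finsum_cong') auto
    then have "a (n + k) = \<zero>" unfolding rec by simp
    \<comment> \<open>The window at \<open>Suc n\<close> is zero as well, hence equal to the one at
      \<open>n\<close>.\<close>
    then have "a (n + t) = a (Suc n + t)" if "t < k" for t
      using zero[of t] zero[of "Suc t"] that by (cases "Suc t = k") auto
    then have "a (l + (Suc n - n)) = a l" for l
      using lin_rec_repeated_state_imp_period[OF lr k, of n "Suc n" l] by blast
    then show ?thesis using N by (intro exI[of _ 1]) auto
  next
    case False
    have fin_states: "finite ({..<k} \<rightarrow>\<^sub>E carrier R)"
      using fin by (simp add: finite_PiE)
    \<comment> \<open>The \<open>?N\<close> windows starting below \<open>?N\<close> avoid
      \<open>z\<close>, so two of them coincide, at distance at most \<open>?N - 1\<close>.\<close>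
    have "s ` {..<?N} \<subseteq> ({..<k} \<rightarrow>\<^sub>E carrier R) - {z}"
      using False a by (auto simp: s_def split: if_splits)
    then have "card (s ` {..<?N}) \<le> card (({..<k} \<rightarrow>\<^sub>E carrier R) - {z})"
      using fin_states by (intro card_mono) auto
    also have "\<dots> = ?N - 1"
      using fin_states by (subst card_Diff_singleton) (auto simp: z_def card_PiE)
    also have "\<dots> < card {..<?N}" using N by simp
    finally have "\<not> inj_on s {..<?N}" by (rule pigeonhole)
    then obtain i j where ij: "i < j" "j < ?N" "s i = s j"
      unfolding inj_on_def by (metis lessThan_iff linorder_neqE_nat)
    then have "a (n + (j - i)) = a n" for n
      using lin_rec_repeated_state_imp_period[OF lr k] s_eqD by metis
    then show ?thesis using ij by (intro exI[of _ "j - i"]) auto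
  qed
qed

lemma least_period_le:
  assumes "0 < m" and "\<And>n. a (n + m) = a n"
  shows "least_period a \<le> m"
  unfolding least_period_def using assms by (intro Least_le) auto

section \<open>Direct products of finite fields\<close>

lemma RDirProd_list_Cons_simps:
  assumes "x \<in> carrier R" "xs \<in> carrier (RDirProd_list Rs)"
    and "y \<in> carrier R" "ys \<in> carrier (RDirProd_list Rs)"
  shows "(x # xs) \<otimes>\<^bsub>RDirProd_list (R # Rs)\<^esub> (y # ys) = (x \<otimes>\<^bsub>R\<^esub> y) # (xs \<otimes>\<^bsub>RDirProd_list Rs\<^esub> ys)"
    and "(x # xs) \<oplus>\<^bsub>RDirProd_list (R # Rs)\<^esub> (y # ys) = (x \<oplus>\<^bsub>R\<^esub> y) # (xs \<oplus>\<^bsub>RDirProd_list Rs\<^esub> ys)"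
  using ring_hom_mult[OF RDirProd_list_hom1, of "(x, xs)" R Rs "(y, ys)"]
    ring_hom_add[OF RDirProd_list_hom1, of "(x, xs)" R Rs "(y, ys)"] assms
  by (simp_all add: RDirProd_carrier) (simp_all add: RDirProd_def DirProd_def monoid.defs)

lemma RDirProd_list_hd_hom: "hd \<in> ring_hom (RDirProd_list (R # Rs)) R"
  by (auto simp: ring_hom_def RDirProd_list_carrier RDirProd_list_Cons_simps RDirProd_list_one)

lemma RDirProd_list_tl_hom: "tl \<in> ring_hom (RDirProd_list (R # Rs)) (RDirProd_list Rs)"
  by (auto simp: ring_hom_def RDirProd_list_carrier RDirProd_list_Cons_simps RDirProd_list_one)

lemma card_RDirProd_list_Cons:
  "card (carrier (RDirProd_list (R # Rs))) = card (carrier R) * card (carrier (RDirProd_list Rs))"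
  unfolding RDirProd_list_carrier by (subst card_image) (auto simp: inj_on_def card_cartesian_product)

lemma finite_RDirProd_list:
  "(\<And>R. R \<in> set Rs \<Longrightarrow> finite (carrier R)) \<Longrightarrow> finite (carrier (RDirProd_list Rs))"
  by (induction Rs) (auto simp: RDirProd_list_carrier)

lemma (in field) finite_field_card_ge_2:
  "finite (carrier R) \<Longrightarrow> 2 \<le> card (carrier R)"
  using card_mono[of "carrier R" "{\<zero>, \<one>}"] by simp

text \<open>Guarantees that a nonempty tail of the product has at least two elements, as the period
  bound requires.\<close>

lemma RDirProd_list_card_ge:
  assumes "\<And>F. F \<in> set Fs \<Longrightarrow> field F \<and> finite (carrier F)"
  shows "2 ^ length Fs \<le> card (carrier (RDirProd_list Fs))"
  using assms
proof (induction Fs)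
  case (Cons F Fs)
  then have "2 \<le> card (carrier F)" using field.finite_field_card_ge_2 by auto
  with Cons show ?case unfolding card_RDirProd_list_Cons by (auto intro: mult_mono)
qed auto

lemma period_mult:
  fixes f :: "nat \<Rightarrow> 'a"
  assumes "\<And>n. f (n + p) = f n"
  shows "f (n + l * p) = f n"
proof (induction l)
  case (Suc l)
  then show ?case using assms[of "n + l * p"] by (simp add: algebra_simps)
qed simp

text \<open>Only the first factor is split off. The tail \<open>?G\<close> is treated merely as a
  finite ring, to which the period bound applies just as it does to a field.\<close>

lemma least_period_RDirProd_list_less:
  assumes fields: "\<And>F. F \<in> set Fs \<Longrightarrow> field F \<and> finite (carrier F)"
    and "length Fs \<ge> 2" and k: "k \<ge> 1" and lr: "lin_rec (RDirProd_list Fs) k c a"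
  shows "least_period a < card (carrier (RDirProd_list Fs)) ^ k - 1"
proof -
  obtain F Gs where Fs: "Fs = F # Gs" and "Gs \<noteq> []"
    using \<open>length Fs \<ge> 2\<close> by (cases Fs) (auto simp: Suc_le_eq)
  let ?G = "RDirProd_list Gs"
  have F: "field F" "finite (carrier F)" using fields by (auto simp: Fs)
  have "ring (RDirProd_list Fs)"
    using fields nth_mem by (intro RDirProd_list_is_ring) (blast intro: field.is_ring)
  have "ring ?G"
    using fields nth_mem[of _ Gs] unfolding Fs
    by (intro RDirProd_list_is_ring) (auto intro: field.is_ring)
  have hd: "ring_hom_ring (RDirProd_list Fs) F hd"
    and tl: "ring_hom_ring (RDirProd_list Fs) ?G tl"
    using RDirProd_list_hd_hom RDirProd_list_tl_hom \<open>ring ?G\<close> \<open>ring (RDirProd_list Fs)\<close> F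
    by (auto simp: Fs field.is_ring intro!: ring_hom_ringI2)
  let ?A = "card (carrier F) ^ k" and ?B = "card (carrier ?G) ^ k"
  have cardF: "2 \<le> card (carrier F)" using F field.finite_field_card_ge_2 by auto
  have "(2::nat) \<le> 2 ^ length Gs" using \<open>Gs \<noteq> []\<close> self_le_power[of "2::nat" "length Gs"] by (simp add: Suc_le_eq)
  then have cardG: "2 \<le> card (carrier ?G)"
    using RDirProd_list_card_ge[of Gs] fields by (auto simp: Fs)
  obtain m where m: "0 < m" "m \<le> ?A - 1" "\<And>n. hd (a (n + m)) = hd (a n)"
    using ring.lin_rec_ex_period[OF field.is_ring ring_hom_ring.lin_rec_hom[OF hd lr]] F k cardF
    by auto
  obtain m' where m': "0 < m'" "m' \<le> ?B - 1" "\<And>n. tl (a (n + m')) = tl (a n)"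
    using ring.lin_rec_ex_period[OF \<open>ring ?G\<close> ring_hom_ring.lin_rec_hom[OF tl lr] k]
      finite_RDirProd_list[of Gs] fields cardG by (auto simp: Fs)
  \<comment> \<open>The terms are nonempty lists, so equality is tested on head and tail;
    \<open>m * m'\<close> is a multiple of both component periods.\<close>
  have "a (n + m * m') = a n" for n
  proof (rule list.expand)
    have "a n \<noteq> []" for n
      using lr RDirProd_list_carrier_mem(1)[of "a n" Fs] by (auto simp: lin_rec_def Fs)
    then show "(a (n + m * m') = []) = (a n = [])" by simp
    show "hd (a (n + m * m')) = hd (a n) \<and> tl (a (n + m * m')) = tl (a n)"
      using period_mult[of "\<lambda>n. hd (a n)" m n m'] period_mult[of "\<lambda>n. tl (a n)" m' n m] m m'
      by (simp add: mult.commute)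
  qed
  then have "least_period a \<le> m * m'"
    using m m' by (intro least_period_le) auto
  also have "m * m' \<le> (?A - 1) * (?B - 1)" using m m' by (intro mult_mono) auto
  also have "\<dots> < ?A * ?B - 1"
  proof -
    have "2 \<le> ?A" "2 \<le> ?B"
      using cardF cardG self_le_power[of "card (carrier F)" k]
        self_le_power[of "card (carrier ?G)" k] k by linarith+
    \<comment> \<open>This form removes the truncated subtractions: the claim becomes (x+1)(y+1) <
      (x+2)(y+2) - 1.\<close>
    then obtain x y where "?A = x + 2" "?B = y + 2"
      by (metis add.commute le_Suc_ex)
    then show ?thesis by (simp add: algebra_simps)
  qed
  finally show ?thesis by (simp add: Fs card_RDirProd_list_Cons power_mult_distrib)
qed

subsection \<open>Fixed points of the Frobenius map\<close>

lemma (in cring) binomial: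
  assumes x: "x \<in> carrier R" and y: "y \<in> carrier R"
  shows "(x \<oplus> y) [^] n = (\<Oplus>i\<in>{..n}. add_pow R (n choose i) (x [^] i \<otimes> y [^] (n - i)))"
proof (induction n)
  case 0
  show ?case by simp
next
  case (Suc n)
  define f where "f n i = add_pow R (n choose i) (x [^] i \<otimes> y [^] (n - i))" for n i
  have f [simp]: "f n i \<in> carrier R" for n i using x y by (simp add: f_def)
  \<comment> \<open>This zero term lengthens the sum by one, so that Pascal's rule also holds at the
    upper end of the range.\<close>
  have f_Suc: "f n (Suc n) = \<zero>" by (simp add: f_def binomial_eq_0)
  have pascal: "f (Suc n) (Suc i) = f n i \<otimes> x \<oplus> f n (Suc i) \<otimes> y" for i
  proof -
    have "f n i \<otimes> x = add_pow R (n choose i) (x [^] Suc i \<otimes> y [^] (n - i))"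
      unfolding f_def using x y by (simp add: add_pow_ldistr) (simp add: m_ac)
    moreover have "f n (Suc i) \<otimes> y = add_pow R (n choose Suc i) (x [^] Suc i \<otimes> y [^] (n - i))"
    proof (cases "i < n")
      case True
      then have "y [^] (n - i) = y [^] (n - Suc i) \<otimes> y"
        by (metis Suc_diff_Suc nat_pow_Suc)
      then show ?thesis
        unfolding f_def using x y by (simp add: add_pow_ldistr m_assoc)
    qed (use y in \<open>simp add: f_def binomial_eq_0\<close>)
    ultimately show ?thesis
      unfolding f_def using x y by (simp add: add.nat_pow_mult)
  qed
  have "(x \<oplus> y) [^] Suc n = (\<Oplus>i\<in>{..n}. f n i) \<otimes> x \<oplus> (\<Oplus>i\<in>{..n}. f n i) \<otimes> y"
    using Suc x y by (simp add: f_def r_distr)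
  also have "(\<Oplus>i\<in>{..n}. f n i) \<otimes> y = (\<Oplus>i\<in>{..Suc n}. f n i) \<otimes> y"
    using finsum_closed[of "f n" "{..n}"] by (subst finsum_Suc) (auto simp: f_Suc)
  also have "\<dots> = (\<Oplus>i\<in>{..n}. f n (Suc i) \<otimes> y) \<oplus> f n 0 \<otimes> y"
    by (subst finsum_Suc2) (use y in \<open>auto simp: l_distr finsum_ldistr\<close>)
  also have "f n 0 \<otimes> y = f (Suc n) 0"
    using y by (simp add: f_def)
  also have "(\<Oplus>i\<in>{..n}. f n i) \<otimes> x \<oplus> ((\<Oplus>i\<in>{..n}. f n (Suc i) \<otimes> y) \<oplus> f (Suc n) 0)
      = (\<Oplus>i\<in>{..n}. f (Suc n) (Suc i)) \<oplus> f (Suc n) 0"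
    using x y by (simp add: pascal finsum_addf finsum_ldistr a_assoc)
  also have "\<dots> = (\<Oplus>i\<in>{..Suc n}. f (Suc n) i)"
    by (subst finsum_Suc2) auto
  finally show ?case by (simp add: f_def)
qed

text \<open>For 0 < i < p the coefficient \<open>p choose i\<close> is a multiple of
  \<open>p\<close> and acts as zero, which leaves the two extreme terms of the binomial sum. The
  hypothesis on \<open>add_pow\<close> says that the characteristic divides
  \<open>p\<close>.\<close>

lemma (in cring) prime_char_pow_add:
  assumes x: "x \<in> carrier R" and y: "y \<in> carrier R"
    and p: "Factorial_Ring.prime (p::nat)" "add_pow R p \<one> = \<zero>"
  shows "(x \<oplus> y) [^] p = x [^] p \<oplus> y [^] p"
proof -
  obtain m where m: "p = Suc m" using prime_gt_0_nat[OF p(1)] gr0_implies_Suc by blast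
  have kill: "add_pow R p z = \<zero>" if "z \<in> carrier R" for z
    using add_pow_ldistr[OF one_closed that, of p] p(2) that by simp
  define f where "f i = add_pow R (p choose i) (x [^] i \<otimes> y [^] (p - i))" for i
  have f: "f i \<in> carrier R" for i using x y by (simp add: f_def)
  have zero: "f i = \<zero>" if "0 < i" "i < p" for i
  proof -
    have "p dvd p choose i"
      using dvd_choose_prime[of i p] that p(1) by auto
    then obtain l where l: "p choose i = p * l" by (elim dvdE)
    have "f i = add_pow R l (add_pow R p (x [^] i \<otimes> y [^] (p - i)))"
      unfolding f_def l using x y by (simp add: add.nat_pow_pow)
    then show ?thesis using x y kill by simp
  qed
  have "(x \<oplus> y) [^] p = (\<Oplus>i\<in>{..Suc m}. f i)"
    unfolding binomial[OF x y] f_def m ..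
  also have "\<dots> = f p \<oplus> (\<Oplus>i\<in>{..m}. f i)"
    using f by (subst finsum_Suc) (auto simp: m)
  also have "(\<Oplus>i\<in>{..m}. f i) = (\<Oplus>i\<in>{..m}. if 0 = i then f i else \<zero>)"
    using f zero by (intro finsum_cong') (auto simp: m)
  also have "\<dots> = f 0"
    using f by (subst finsum_singleton) auto
  finally show ?thesis using x y by (simp add: f_def)
qed

text \<open>Prime factors of \<open>n\<close> are peeled off one at a time, each by the prime case.
  The hypothesis on prime divisors has the shape that \<open>prime_dvd_card_imp_char\<close>
  delivers for the order of a finite field.\<close>

lemma (in cring) pow_add_if_prime_factors_vanish:
  assumes "n > 0" and "\<And>r. Factorial_Ring.prime r \<Longrightarrow> r dvd n \<Longrightarrow> add_pow R r \<one> = \<zero>"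
    and "x \<in> carrier R" and "y \<in> carrier R"
  shows "(x \<oplus> y) [^] (n::nat) = x [^] n \<oplus> y [^] n"
  using assms
proof (induction n arbitrary: x y rule: less_induct)
  case (less n)
  show ?case
  proof (cases "n = 1")
    case True
    then show ?thesis using less.prems by simp
  next
    case False
    then obtain r where r: "Factorial_Ring.prime r" "r dvd n"
      using prime_factor_nat by blast
    then obtain m where m: "n = r * m" by (elim dvdE)
    have "m < n" "m > 0" using m \<open>n > 0\<close> prime_gt_1_nat[OF r(1)] by auto
    have "(x \<oplus> y) [^] n = ((x \<oplus> y) [^] r) [^] m"
      using less.prems by (simp add: m nat_pow_pow)
    also have "\<dots> = (x [^] r \<oplus> y [^] r) [^] m"
      using prime_char_pow_add r less.prems by simp
    also have "\<dots> = (x [^] r) [^] m \<oplus> (y [^] r) [^] m"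
      using less.prems m by (intro less.IH \<open>m < n\<close> \<open>m > 0\<close>) auto
    finally show ?thesis using less.prems by (simp add: m nat_pow_pow)
  qed
qed

text \<open>Sylow's theorem with exponent 1 gives an additive subgroup of order \<open>r\<close>,
  hence a nonzero \<open>x\<close> killed by \<open>r\<close>. As there are no zero divisors,
  \<open>r\<close> times 1 must vanish.\<close>

lemma (in domain) prime_dvd_card_imp_char:
  assumes fin: "finite (carrier R)" and r: "Factorial_Ring.prime r" "r dvd card (carrier R)"
  shows "add_pow R r \<one> = \<zero>"
proof -
  obtain m where "order (add_monoid R) = r ^ 1 * m"
    using r(2) by (auto simp: order_def elim: dvdE)
  then obtain H where H: "subgroup H (add_monoid R)" "card H = r ^ 1"
    using sylow_thm[OF r(1) a_group, of 1 m] fin by auto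
  have "\<not> H \<subseteq> {\<zero>}"
    using card_mono[of "{\<zero>}" H] H(2) prime_gt_1_nat[OF r(1)] by auto
  then obtain x where x: "x \<in> H" "x \<noteq> \<zero>" by auto
  have xR: "x \<in> carrier R" using x subgroup.subset[OF H(1)] by auto
  interpret H: group "add_monoid R\<lparr>carrier := H\<rparr>"
    using subgroup.subgroup_is_group[OF H(1) a_group] .
  have "x [^]\<^bsub>add_monoid R\<lparr>carrier := H\<rparr>\<^esub> r = \<one>\<^bsub>add_monoid R\<lparr>carrier := H\<rparr>\<^esub>"
    using H.pow_order_eq_1[of x] x H(2) by (simp add: order_def)
  then have "add_pow R r x = \<zero>"
    by (simp add: add_pow_def nat_pow_def)
  then have "add_pow R r \<one> \<otimes> x = \<zero>" using xR add_pow_ldistr by simp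
  then show ?thesis using x xR integral[of "add_pow R r \<one>" x] by auto
qed

lemma (in ring_hom_ring) hom_add_pow:
  "x \<in> carrier R \<Longrightarrow> h (add_pow R (n::nat) x) = [n] \<cdot>\<^bsub>S\<^esub> h x"
  by (induction n) auto


text \<open>\<open>K'\<close> is the root set of X^N - X. It is a field because the N-th power map
  is additive and multiplicative, and it has \<open>N\<close> elements because the polynomial splits
  in \<open>L\<close> with simple roots only.\<close>

lemma (in algebraic_closure) fixed_points_of_frobenius:
  assumes fin: "finite K" and N: "N = card K ^ k" "k \<ge> 1"
  defines "K' \<equiv> {x \<in> carrier L. x [^] N = x}"
  shows "subfield K' L" and "K \<subseteq> K'" and "card K' = N"
proof -
  interpret Kf: field "L\<lparr>carrier := K\<rparr>"
    using subfield_iff(2)[OF subfield_axioms] .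
  have K_sub: "K \<subseteq> carrier L" using subfieldE(3)[OF subfield_axioms] .
  have K_ring: "subring K L" using subfieldE(1)[OF subfield_axioms] .
  have "2 \<le> card K" using Kf.finite_field_card_ge_2 fin by simp
  then have N2: "2 \<le> N" using self_le_power[of "card K" k] N by linarith
  have char: "add_pow L r \<one> = \<zero>" if r: "Factorial_Ring.prime r" "r dvd N" for r
  proof -
    have "r dvd card K" using r N prime_dvd_power by blast
    then show ?thesis
      using Kf.prime_dvd_card_imp_char[of r] r fin by (simp add: add_pow_def nat_pow_def)
  qed
  have pow_add: "(x \<oplus> y) [^] N = x [^] N \<oplus> y [^] N" if "x \<in> carrier L" "y \<in> carrier L" for x y
    using pow_add_if_prime_factors_vanish[of N x y] char that N2 by auto
  show "subfield K' L"
  proof (rule subfieldI'[OF subringI])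
    show "K' \<subseteq> carrier L" "\<one> \<in> K'" by (auto simp: K'_def)
  next
    fix x assume x: "x \<in> K'"
    \<comment> \<open>Expanding (x + (-x))^N additively gives (-x)^N = -x whatever the parity of
      \<open>N\<close>.\<close>
    then have "x \<oplus> (\<ominus> x) [^] N = \<zero>"
      using pow_add[of x "\<ominus> x"] N2 by (simp add: K'_def r_neg nat_pow_zero)
    then show "\<ominus> x \<in> K'"
      using x minus_equality[of "(\<ominus> x) [^] N" x] by (simp add: K'_def a_comm)
  next
    fix x y assume "x \<in> K'" "y \<in> K'"
    then show "x \<otimes> y \<in> K'" "x \<oplus> y \<in> K'"
      using pow_add by (auto simp: K'_def nat_pow_distrib)
  next
    fix x assume "x \<in> K' - {\<zero>}"
    then have x: "x \<in> Units L" "x \<in> carrier L" "x [^] N = x"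
      by (auto simp: K'_def field_Units)
    then have "x \<otimes> (inv x) [^] N = \<one>"
      using nat_pow_distrib[of x "inv x" N] by simp
    then show "inv x \<in> K'"
      using x comm_inv_char[of x "(inv x) [^] N"] by (simp add: K'_def)
  qed
  show "K \<subseteq> K'"
  proof
    fix x assume x: "x \<in> K"
    \<comment> \<open>For nonzero \<open>x\<close>, Lagrange's theorem in the units of
      \<open>K\<close> gives x^q = x with q = \<open>card K\<close>; iterating reaches q^k =
      N.\<close>
    have "x [^] card K ^ j = x" for j
    proof (induction j)
      case (Suc j)
      have "x [^] card K = x"
      proof (cases "x = \<zero>")
        case False
        have "Units (L\<lparr>carrier := K\<rparr>) = K - {\<zero>}" using Kf.field_Units by simp
        then have "x [^] card (K - {\<zero>}) = \<one>"
          using Kf.units_power_order_eq_one[of x] x False fin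
          by (simp add: nat_pow_consistent[symmetric])
        moreover have "card K = Suc (card (K - {\<zero>}))"
          using fin subringE(2)[OF K_ring] by (metis card.remove)
        ultimately show ?thesis using x K_sub by auto
      qed (use \<open>2 \<le> card K\<close> in \<open>simp add: nat_pow_zero\<close>)
      then show ?case using Suc x K_sub nat_pow_pow[of x "card K" "card K ^ j"] by auto
    qed (use x K_sub in auto)
    then show "x \<in> K'" using x K_sub by (auto simp: K'_def N)
  qed
  show "card K' = N"
  proof -
    interpret UP: domain "poly_ring L"
      using univ_poly_is_domain[OF carrier_is_subring] .
    interpret const: ring_hom_ring L "poly_ring L" poly_of_const
      using canonical_embedding_ring_hom[OF carrier_is_subring] by simp
    \<comment> \<open>Coefficient lists start with the leading coefficient, so this is X^N -
      X.\<close>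
    define p where "p = poly_add (monom \<one> N) [\<ominus> \<one>, \<zero>]"
    have poly: "polynomial A (monom \<one> N)" "polynomial A [\<ominus> \<one>, \<zero>]" if "subring A L" for A
      using subringE(2,3,5)[OF that] by (auto simp: monom_def polynomial_def)
    \<comment> \<open>Coefficients in \<open>K\<close> are what makes \<open>p\<close> split in its
      algebraic closure \<open>L\<close>; multiplicities of roots are then studied in the polynomial
      ring over \<open>L\<close>.\<close>
    have pK: "p \<in> carrier (K[X])"
      unfolding p_def univ_poly_carrier[symmetric] using poly_add_closed[OF K_ring] poly[OF K_ring] by blast
    have pL: "p \<in> carrier (poly_ring L)"
      unfolding p_def univ_poly_carrier[symmetric]
      using poly_add_closed[OF carrier_is_subring] poly[OF carrier_is_subring] by blast
    have deg: "degree p = N"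
      unfolding p_def using poly_add_degree_eq[OF K_ring poly[OF K_ring]] N2
      by (simp add: monom_def del: poly_add.simps)
    then have "p \<noteq> []" using N2 by auto
    have eval: "eval p x = x [^] N \<ominus> x" if "x \<in> carrier L" for x
      unfolding p_def
      using eval_poly_add[of "monom \<one> N" "[\<ominus> \<one>, \<zero>]" x] monom_in_carrier[of \<one> N] that
      by (simp add: eval_monom a_minus_def l_minus del: poly_add.simps)
    have p_eq: "p = X [^]\<^bsub>poly_ring L\<^esub> N \<ominus>\<^bsub>poly_ring L\<^esub> X"
      unfolding p_def a_minus_def
      using univ_poly_a_inv_def'[OF carrier_is_subring var_closed(1)[OF carrier_is_subring]]
      by (simp add: unitary_monom_eq_var_pow[OF carrier_is_subring] univ_poly_add var_def
          del: poly_add.simps)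
    \<comment> \<open>For \<open>a \<in> K'\<close> additivity of the \<open>N\<close>-th power gives \<open>X\<^bsup>N\<^esup> - X = (X - a)\<^bsup>N\<^esup> - (X - a)\<close>,
      which \<open>(X - a)\<^sup>2\<close> does not divide.\<close>
    have simple: "alg_mult p a \<le> 1" if a: "a \<in> K'" for a
    proof (rule ccontr)
      assume "\<not> alg_mult p a \<le> 1"
      have aL: "a \<in> carrier L" using a by (simp add: K'_def)
      define Y where "Y = [\<one>, \<ominus> a]"
      define C where "C = poly_of_const a"
      have Y: "Y \<in> carrier (poly_ring L)"
        using aL by (simp add: Y_def polynomial_def flip: univ_poly_carrier)
      have C: "C \<in> carrier (poly_ring L)" "C [^]\<^bsub>poly_ring L\<^esub> N = C"
        using a aL const.hom_nat_pow[of a N] by (simp_all add: C_def K'_def)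
      have X: "X = Y \<oplus>\<^bsub>poly_ring L\<^esub> C"
        using aL by (simp add: var_def Y_def C_def poly_of_const_def univ_poly_add l_neg)
      have "add_pow (poly_ring L) r \<one>\<^bsub>poly_ring L\<^esub> = \<zero>\<^bsub>poly_ring L\<^esub>"
        if "Factorial_Ring.prime r" "r dvd N" for r
        using const.hom_add_pow[of \<one> r] char[OF that] by simp
      then have "X [^]\<^bsub>poly_ring L\<^esub> N = Y [^]\<^bsub>poly_ring L\<^esub> N \<oplus>\<^bsub>poly_ring L\<^esub> C"
        unfolding X using UP.pow_add_if_prime_factors_vanish[of N Y C] Y C N2 by auto
      then have "p = (Y [^]\<^bsub>poly_ring L\<^esub> N \<oplus>\<^bsub>poly_ring L\<^esub> C) \<ominus>\<^bsub>poly_ring L\<^esub> (Y \<oplus>\<^bsub>poly_ring L\<^esub> C)"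
        unfolding p_eq by (simp add: X)
      also have "\<dots> = Y [^]\<^bsub>poly_ring L\<^esub> N \<ominus>\<^bsub>poly_ring L\<^esub> Y"
        using C(1) Y UP.nat_pow_closed[OF Y, of N] by algebra
      finally have p_Y: "p = Y [^]\<^bsub>poly_ring L\<^esub> N \<ominus>\<^bsub>poly_ring L\<^esub> Y" .
      have "Y [^]\<^bsub>poly_ring L\<^esub> (2::nat) divides\<^bsub>poly_ring L\<^esub> p"
        using le_alg_mult_imp_pdivides[OF aL pL, of 2] \<open>\<not> alg_mult p a \<le> 1\<close>
        by (simp add: Y_def pdivides_def)
      then obtain u where u: "u \<in> carrier (poly_ring L)" "p = Y [^]\<^bsub>poly_ring L\<^esub> (2::nat) \<otimes>\<^bsub>poly_ring L\<^esub> u"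
        by (auto simp: factor_def)
      define w where "w = Y [^]\<^bsub>poly_ring L\<^esub> (N - 2)"
      have w: "w \<in> carrier (poly_ring L)" using Y by (simp add: w_def)
      have Y2: "Y [^]\<^bsub>poly_ring L\<^esub> (2::nat) \<in> carrier (poly_ring L)" using Y by simp
      have YN: "Y [^]\<^bsub>poly_ring L\<^esub> N = Y [^]\<^bsub>poly_ring L\<^esub> (2::nat) \<otimes>\<^bsub>poly_ring L\<^esub> w"
        using UP.nat_pow_mult[OF Y, of 2 "N - 2"] N2 unfolding w_def by (metis le_add_diff_inverse)
      \<comment> \<open>Both Y^N and \<open>p\<close> are multiples of Y^2, hence so is their
        difference \<open>Y\<close>, which has degree 1.\<close>
      have "Y = Y [^]\<^bsub>poly_ring L\<^esub> N \<ominus>\<^bsub>poly_ring L\<^esub> p"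
        unfolding p_Y using Y UP.nat_pow_closed[OF Y, of N] by algebra
      also have "\<dots> = Y [^]\<^bsub>poly_ring L\<^esub> (2::nat) \<otimes>\<^bsub>poly_ring L\<^esub> (w \<ominus>\<^bsub>poly_ring L\<^esub> u)"
        unfolding YN u(2) using u(1) w Y2 by algebra
      finally have "Y [^]\<^bsub>poly_ring L\<^esub> (2::nat) pdivides Y"
        unfolding pdivides_def factor_def using u w by blast
      then have "degree (Y [^]\<^bsub>poly_ring L\<^esub> (2::nat)) \<le> degree Y"
        using pdivides_imp_degree_le[OF carrier_is_subring Y2 Y] by (simp add: Y_def)
      then show False
        using polynomial_pow_degree[OF Y, of 2] by (simp add: Y_def)
    qed
    have roots: "set_mset (roots p) = K'"
    proof -
      have "x [^] N \<ominus> x = \<zero> \<longleftrightarrow> x [^] N = x" if "x \<in> carrier L" for x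
        using that r_right_minus_eq by simp
      then show ?thesis
        using roots_mem_iff_is_root[OF pL] eval \<open>p \<noteq> []\<close> by (auto simp: is_root_def K'_def)
    qed
    \<comment> \<open>Splitting yields \<open>N\<close> roots counted with multiplicity; simplicity
      makes them distinct.\<close>
    have "size (roots p) = N" using roots_over_subfield[OF pK] deg by (simp add: splitted_def)
    moreover have "size (roots p) = card (set_mset (roots p))"
    proof -
      have "count (roots p) x = 1" if "x \<in># roots p" for x
        using that simple[of x] roots alg_mult_eq_count_roots[OF pL]
        by (metis One_nat_def Suc_leI count_greater_zero_iff le_antisym)
      then show ?thesis by (simp add: size_multiset_overloaded_eq)
    qed
    ultimately show ?thesis by (simp add: roots)
  qed
qed

subsection \<open>Sequences from a primitive element\<close>

text \<open>\<open>S\<close> plays the extension of degree \<open>k\<close> of the base field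
  \<open>R\<close>. The two are linked by an embedding \<open>h\<close> instead of an inclusion
  because the algebraic closure lives in a different type.\<close>

locale primitive_extension = ring_hom_ring R S h + R: field R + S: field S
  for R (structure) and S (structure) and h +
  fixes \<alpha> and k :: nat
  assumes finite_base: "finite (carrier R)"
    and card_ext: "card (carrier S) = card (carrier R) ^ k"
    and k_pos: "k \<ge> 1"
    and alpha [simp]: "\<alpha> \<in> carrier S"
    and generator: "carrier S - {\<zero>\<^bsub>S\<^esub>} = range (\<lambda>i::nat. \<alpha> [^]\<^bsub>S\<^esub> i)"
begin

section \<open>Linear combinations of the powers of the generator\<close>

definition comb :: "nat \<Rightarrow> (nat \<Rightarrow> 'a) \<Rightarrow> 'c" where
  "comb j f = (\<Oplus>\<^bsub>S\<^esub>i\<in>{..<j}. h (f i) \<otimes>\<^bsub>S\<^esub> \<alpha> [^]\<^bsub>S\<^esub> i)"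

text \<open>Coefficients are total functions of which only the values below \<open>j\<close> matter,
  so uniqueness of coefficients is later stated pointwise below the bound.\<close>

definition span :: "nat \<Rightarrow> 'c set" where
  "span j = comb j ` ({..<j} \<rightarrow> carrier R)"

lemma alpha_nonzero: "\<alpha> \<noteq> \<zero>\<^bsub>S\<^esub>"
proof -
  have "\<alpha> [^]\<^bsub>S\<^esub> (1::nat) \<in> carrier S - {\<zero>\<^bsub>S\<^esub>}" unfolding generator by blast
  then show ?thesis by simp
qed

lemma finite_ext: "finite (carrier S)"
  using card_ext R.finite_field_card_ge_2[OF finite_base] by (intro card_ge_0_finite) simp

lemma comb_closed [simp]: "f \<in> {..<j} \<rightarrow> carrier R \<Longrightarrow> comb j f \<in> carrier S"
  unfolding comb_def by (intro S.finsum_closed) (simp add: Pi_iff)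

lemma comb_cong:
  "f \<in> {..<j} \<rightarrow> carrier R \<Longrightarrow> (\<And>i. i < j \<Longrightarrow> f i = g i) \<Longrightarrow> comb j f = comb j g"
  unfolding comb_def by (intro S.finsum_cong') (auto simp: Pi_iff)

lemma comb_0 [simp]: "comb 0 f = \<zero>\<^bsub>S\<^esub>"
  by (simp add: comb_def)

lemma comb_Suc:
  "f \<in> {..<Suc j} \<rightarrow> carrier R \<Longrightarrow>
    comb (Suc j) f = h (f j) \<otimes>\<^bsub>S\<^esub> \<alpha> [^]\<^bsub>S\<^esub> j \<oplus>\<^bsub>S\<^esub> comb j f"
  unfolding comb_def lessThan_Suc by (subst S.finsum_insert) (auto simp: Pi_iff)

lemma comb_linear:
  assumes f: "f \<in> {..<j} \<rightarrow> carrier R" and g: "g \<in> {..<j} \<rightarrow> carrier R" and c: "c \<in> carrier R"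
  shows "comb j (\<lambda>i. c \<otimes> f i \<oplus> g i) = h c \<otimes>\<^bsub>S\<^esub> comb j f \<oplus>\<^bsub>S\<^esub> comb j g"
  using f g
proof (induction j)
  case 0
  show ?case using c by simp
next
  case (Suc j)
  have mem: "f j \<in> carrier R" "g j \<in> carrier R" "f \<in> {..<j} \<rightarrow> carrier R" "g \<in> {..<j} \<rightarrow> carrier R"
    using Suc.prems by auto
  have "comb (Suc j) (\<lambda>i. c \<otimes> f i \<oplus> g i) =
      h (c \<otimes> f j \<oplus> g j) \<otimes>\<^bsub>S\<^esub> \<alpha> [^]\<^bsub>S\<^esub> j \<oplus>\<^bsub>S\<^esub> (h c \<otimes>\<^bsub>S\<^esub> comb j f \<oplus>\<^bsub>S\<^esub> comb j g)"
    using Suc c mem by (subst comb_Suc) auto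
  also have "\<dots> = h c \<otimes>\<^bsub>S\<^esub> (h (f j) \<otimes>\<^bsub>S\<^esub> \<alpha> [^]\<^bsub>S\<^esub> j \<oplus>\<^bsub>S\<^esub> comb j f) \<oplus>\<^bsub>S\<^esub>
      (h (g j) \<otimes>\<^bsub>S\<^esub> \<alpha> [^]\<^bsub>S\<^esub> j \<oplus>\<^bsub>S\<^esub> comb j g)"
  proof -
    have "h (f j) \<in> carrier S" "h (g j) \<in> carrier S" "h c \<in> carrier S"
      "\<alpha> [^]\<^bsub>S\<^esub> j \<in> carrier S" "comb j f \<in> carrier S" "comb j g \<in> carrier S"
      using mem c by auto
    then show ?thesis
      using mem c by (simp add: S.l_distr S.r_distr S.m_assoc S.a_assoc) (simp add: S.a_lcomm)
  qed
  finally show ?case using Suc.prems by (simp add: comb_Suc)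
qed

text \<open>Multiplication by \<open>\<alpha>\<close> raises every exponent by one;
  \<open>case_nat \<zero> f\<close> shifts the coefficients accordingly and puts a zero in
  front.\<close>

lemma comb_shift:
  "f \<in> {..<j} \<rightarrow> carrier R \<Longrightarrow> \<alpha> \<otimes>\<^bsub>S\<^esub> comb j f = comb (Suc j) (case_nat \<zero> f)"
proof (induction j)
  case 0
  show ?case by (subst comb_Suc) auto
next
  case (Suc j)
  then have mem: "f j \<in> carrier R" "f \<in> {..<j} \<rightarrow> carrier R" by auto
  have shifted: "case_nat \<zero> f \<in> {..<Suc (Suc j)} \<rightarrow> carrier R"
    using Suc.prems by (auto split: nat.split)
  have "\<alpha> \<otimes>\<^bsub>S\<^esub> (h (f j) \<otimes>\<^bsub>S\<^esub> \<alpha> [^]\<^bsub>S\<^esub> j) = h (f j) \<otimes>\<^bsub>S\<^esub> \<alpha> [^]\<^bsub>S\<^esub> Suc j"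
    using mem by (simp add: S.m_ac)
  then show ?case
    using Suc mem by (subst comb_Suc[OF shifted], subst comb_Suc) (auto simp: S.r_distr)
qed

lemma comb_unit: "comb (Suc j) (\<lambda>i. if i = 0 then \<one> else \<zero>) = \<one>\<^bsub>S\<^esub>"
proof (induction j)
  case 0
  show ?case by (subst comb_Suc) auto
next
  case (Suc j)
  then show ?case by (subst comb_Suc) auto
qed

section \<open>Counting argument: the powers below \<open>k\<close> form a basis\<close>

lemma card_span_le: "card (span j) \<le> card (carrier R) ^ j"
proof -
  \<comment> \<open>Restricting coefficients to indices below \<open>j\<close> leaves the
    combination unchanged and moves it into a space of q^j functions, q being the order of
    \<open>R\<close>.\<close>
  have "span j \<subseteq> comb j ` ({..<j} \<rightarrow>\<^sub>E carrier R)"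
  proof
    fix x assume "x \<in> span j"
    then obtain f where f: "f \<in> {..<j} \<rightarrow> carrier R" "x = comb j f" by (auto simp: span_def)
    then have "x = comb j (restrict f {..<j})" by (auto intro: comb_cong)
    then show "x \<in> comb j ` ({..<j} \<rightarrow>\<^sub>E carrier R)" using f by auto
  qed
  moreover have fin: "finite ({..<j} \<rightarrow>\<^sub>E carrier R)"
    using finite_base by (simp add: finite_PiE)
  ultimately have "card (span j) \<le> card (comb j ` ({..<j} \<rightarrow>\<^sub>E carrier R))"
    by (intro card_mono) auto
  also have "\<dots> \<le> card ({..<j} \<rightarrow>\<^sub>E carrier R)" using fin by (rule card_image_le)
  finally show ?thesis by (simp add: card_PiE)
qed

text \<open>If a power of the generator lies in the span of the lower powers, then that span absorbs
  multiplication by the generator and hence is everything.\<close>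

lemma pow_notin_span:
  assumes "j < k"
  shows "\<alpha> [^]\<^bsub>S\<^esub> j \<notin> span j"
proof
  assume "\<alpha> [^]\<^bsub>S\<^esub> j \<in> span j"
  then obtain g where g: "g \<in> {..<j} \<rightarrow> carrier R" "\<alpha> [^]\<^bsub>S\<^esub> j = comb j g"
    by (auto simp: span_def)
  \<comment> \<open>The combination \<open>g\<close> replaces the j-th power, so a top coefficient
    can be redistributed over the lower ones.\<close>
  have absorb: "comb (Suc j) f \<in> span j" if f: "f \<in> {..<Suc j} \<rightarrow> carrier R" for f
  proof -
    have mem: "f j \<in> carrier R" "f \<in> {..<j} \<rightarrow> carrier R" using f by auto
    have "comb (Suc j) f = comb j (\<lambda>i. f j \<otimes> g i \<oplus> f i)"
      using comb_Suc[OF f] comb_linear[OF g(1) mem(2,1)] g(2) by simp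
    moreover have "(\<lambda>i. f j \<otimes> g i \<oplus> f i) \<in> {..<j} \<rightarrow> carrier R"
      using mem g(1) by (simp add: Pi_iff)
    ultimately show ?thesis by (auto simp: span_def)
  qed
  have "\<alpha> [^]\<^bsub>S\<^esub> n \<in> span j" for n :: nat
  proof (induction n)
    case 0
    show ?case using absorb[of "\<lambda>i. if i = 0 then \<one> else \<zero>"] by (simp add: comb_unit)
  next
    case (Suc n)
    then obtain f where f: "f \<in> {..<j} \<rightarrow> carrier R" "\<alpha> [^]\<^bsub>S\<^esub> n = comb j f"
      by (auto simp: span_def)
    then have "\<alpha> [^]\<^bsub>S\<^esub> Suc n = comb (Suc j) (case_nat \<zero> f)"
      using comb_shift[OF f(1)] S.nat_pow_Suc2[OF alpha, of n] by simp
    moreover have "case_nat \<zero> f \<in> {..<Suc j} \<rightarrow> carrier R"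
      using f by (auto split: nat.split)
    ultimately show ?case using absorb by simp
  qed
  moreover have "\<zero>\<^bsub>S\<^esub> \<in> span j"
  proof -
    have "comb (Suc j) (\<lambda>i. \<zero>) = \<zero>\<^bsub>S\<^esub>"
      unfolding comb_def by simp
    then show ?thesis using absorb[of "\<lambda>i. \<zero>"] by simp
  qed
  \<comment> \<open>Every nonzero element is a power of \<open>\<alpha>\<close>, so the span would
    be all of \<open>S\<close>, forcing q^k to be at most q^j.\<close>
  ultimately have "insert \<zero>\<^bsub>S\<^esub> (carrier S - {\<zero>\<^bsub>S\<^esub>}) \<subseteq> span j"
    unfolding generator by auto
  then have "carrier S \<subseteq> span j" by auto
  moreover have "finite (span j)"
    using finite_ext by (rule finite_subset[rotated]) (auto simp: span_def)
  ultimately have "card (carrier S) \<le> card (carrier R) ^ j"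
    using card_span_le[of j] card_mono[of "span j" "carrier S"] by linarith
  then have "card (carrier R) ^ k \<le> card (carrier R) ^ j" by (simp add: card_ext)
  then show False
    using \<open>j < k\<close> R.finite_field_card_ge_2[OF finite_base] by simp
qed

text \<open>Linear independence, from the top down: a nonzero leading coefficient would express that
  power of \<open>\<alpha>\<close> through the lower ones, against
  \<open>pow_notin_span\<close>.\<close>

lemma comb_eq_zeroD:
  assumes "j \<le> k" and "f \<in> {..<j} \<rightarrow> carrier R" and "comb j f = \<zero>\<^bsub>S\<^esub>" and "i < j"
  shows "f i = \<zero>"
  using assms
proof (induction j)
  case (Suc j)
  then have f: "f j \<in> carrier R" "f \<in> {..<j} \<rightarrow> carrier R" by auto
  have eq: "h (f j) \<otimes>\<^bsub>S\<^esub> \<alpha> [^]\<^bsub>S\<^esub> j \<oplus>\<^bsub>S\<^esub> comb j f = \<zero>\<^bsub>S\<^esub>"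
    using Suc.prems by (simp add: comb_Suc)
  show ?case
  proof (cases "f j = \<zero>")
    case True
    then have "comb j f = \<zero>\<^bsub>S\<^esub>" using eq f by simp
    then show ?thesis using Suc f True by (cases "i = j") auto
  next
    case False
    then have unit: "f j \<in> Units R" using f by (simp add: R.field_Units)
    \<comment> \<open>Scaling the relation by \<open>d\<close> turns its leading coefficient into
      -1, so the lower part becomes equal to the j-th power.\<close>
    define d where "d = \<ominus> (inv (f j))"
    have d: "d \<in> carrier R" "d \<otimes> f j = \<ominus> \<one>"
      using unit f by (auto simp: d_def R.l_minus)
    have "h d \<otimes>\<^bsub>S\<^esub> comb j f = \<alpha> [^]\<^bsub>S\<^esub> j"
    proof -
      have "comb j f = \<ominus>\<^bsub>S\<^esub> (h (f j) \<otimes>\<^bsub>S\<^esub> \<alpha> [^]\<^bsub>S\<^esub> j)"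
        using eq f S.minus_equality S.a_comm by (metis S.m_closed S.nat_pow_closed alpha comb_closed hom_closed)
      then have "h d \<otimes>\<^bsub>S\<^esub> comb j f = \<ominus>\<^bsub>S\<^esub> (h (d \<otimes> f j) \<otimes>\<^bsub>S\<^esub> \<alpha> [^]\<^bsub>S\<^esub> j)"
        using d(1) f by (simp add: S.r_minus S.m_assoc)
      then show ?thesis by (simp add: d S.l_minus)
    qed
    moreover have "comb j (\<lambda>i. d \<otimes> f i \<oplus> \<zero>) = h d \<otimes>\<^bsub>S\<^esub> comb j f \<oplus>\<^bsub>S\<^esub> comb j (\<lambda>i. \<zero>)"
      using d f by (intro comb_linear) auto
    moreover have "comb j (\<lambda>i. \<zero>) = \<zero>\<^bsub>S\<^esub>" by (simp add: comb_def)
    ultimately have "\<alpha> [^]\<^bsub>S\<^esub> j = comb j (\<lambda>i. d \<otimes> f i \<oplus> \<zero>)" by simp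
    moreover have "(\<lambda>i. d \<otimes> f i \<oplus> \<zero>) \<in> {..<j} \<rightarrow> carrier R" using d f by auto
    ultimately have "\<alpha> [^]\<^bsub>S\<^esub> j \<in> span j" by (auto simp: span_def)
    then show ?thesis using pow_notin_span[of j] Suc.prems by simp
  qed
qed simp

lemma comb_inj:
  assumes f: "f \<in> {..<k} \<rightarrow> carrier R" and g: "g \<in> {..<k} \<rightarrow> carrier R"
    and eq: "comb k f = comb k g" and i: "i < k"
  shows "f i = g i"
proof -
  have mem: "f i \<in> carrier R" "g i \<in> carrier R" using f g i by auto
  have "comb k (\<lambda>i. \<ominus> \<one> \<otimes> g i \<oplus> f i) = h (\<ominus> \<one>) \<otimes>\<^bsub>S\<^esub> comb k g \<oplus>\<^bsub>S\<^esub> comb k f"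
    using f g by (intro comb_linear) auto
  also have "\<dots> = \<zero>\<^bsub>S\<^esub>" using g by (simp add: eq S.l_minus S.l_neg)
  finally have "\<ominus> \<one> \<otimes> g i \<oplus> f i = \<zero>"
    using f g by (intro comb_eq_zeroD[OF order_refl _ _ i]) (auto simp: Pi_iff)
  then have "f i \<ominus> g i = \<zero>"
    using mem by (simp add: R.l_minus a_minus_def R.a_comm)
  then show ?thesis using mem by simp
qed

text \<open>An injection from the q^k coefficient functions into \<open>S\<close>, which also has
  q^k elements, is onto.\<close>

lemma comb_surj:
  assumes "x \<in> carrier S"
  obtains f where "f \<in> {..<k} \<rightarrow> carrier R" "x = comb k f"
proof -
  have "inj_on (comb k) ({..<k} \<rightarrow>\<^sub>E carrier R)"
  proof (rule inj_onI)
    fix f g assume fg: "f \<in> {..<k} \<rightarrow>\<^sub>E carrier R" "g \<in> {..<k} \<rightarrow>\<^sub>E carrier R" "comb k f = comb k g"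
    then show "f = g"
      using comb_inj[of f g] by (intro PiE_ext[OF fg(1,2)]) (auto simp: PiE_iff)
  qed
  then have "card (comb k ` ({..<k} \<rightarrow>\<^sub>E carrier R)) = card (carrier S)"
    by (simp add: card_image card_PiE card_ext)
  moreover have "comb k ` ({..<k} \<rightarrow>\<^sub>E carrier R) \<subseteq> carrier S"
    by (auto simp: PiE_iff Pi_iff intro!: comb_closed)
  ultimately have "comb k ` ({..<k} \<rightarrow>\<^sub>E carrier R) = carrier S"
    by (intro card_subset_eq finite_ext) auto
  then show thesis using that assms by blast
qed

text \<open>The linear functional reading off the coordinate at 1. The description picks the value
  \<open>f 0\<close>, not \<open>f\<close>, since \<open>f\<close> is determined only below
  \<open>k\<close>.\<close>

definition coord0 :: "'c \<Rightarrow> 'a" where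
  "coord0 x = (THE y. \<exists>f \<in> {..<k} \<rightarrow> carrier R. x = comb k f \<and> y = f 0)"

lemma coord0_comb: "f \<in> {..<k} \<rightarrow> carrier R \<Longrightarrow> coord0 (comb k f) = f 0"
  unfolding coord0_def
proof (rule the_equality)
  fix y assume f: "f \<in> {..<k} \<rightarrow> carrier R"
    and "\<exists>g\<in>{..<k} \<rightarrow> carrier R. comb k f = comb k g \<and> y = g 0"
  then obtain g where "g \<in> {..<k} \<rightarrow> carrier R" "comb k f = comb k g" "y = g 0" by blast
  then show "y = f 0" using comb_inj[OF f, of g 0] k_pos by simp
qed blast

lemma coord0_closed [simp]:
  assumes "x \<in> carrier S"
  shows "coord0 x \<in> carrier R"
proof -
  obtain f where "f \<in> {..<k} \<rightarrow> carrier R" "x = comb k f" using comb_surj[OF assms] .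
  then show ?thesis using k_pos by (auto simp: coord0_comb)
qed

lemma coord0_linear:
  assumes "x \<in> carrier S" and "y \<in> carrier S" and c: "c \<in> carrier R"
  shows "coord0 (h c \<otimes>\<^bsub>S\<^esub> x \<oplus>\<^bsub>S\<^esub> y) = c \<otimes> coord0 x \<oplus> coord0 y"
proof -
  obtain f where f: "f \<in> {..<k} \<rightarrow> carrier R" "x = comb k f" using comb_surj[OF assms(1)] .
  obtain g where g: "g \<in> {..<k} \<rightarrow> carrier R" "y = comb k g" using comb_surj[OF assms(2)] .
  have "h c \<otimes>\<^bsub>S\<^esub> x \<oplus>\<^bsub>S\<^esub> y = comb k (\<lambda>i. c \<otimes> f i \<oplus> g i)"
    using f g c comb_linear by simp
  moreover have "(\<lambda>i. c \<otimes> f i \<oplus> g i) \<in> {..<k} \<rightarrow> carrier R" using f g c by auto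
  ultimately show ?thesis using f g by (simp add: coord0_comb)
qed

lemma coord0_one: "coord0 \<one>\<^bsub>S\<^esub> = \<one>"
  using coord0_comb[of "\<lambda>i. if i = 0 then \<one> else \<zero>"] comb_unit[of "k - 1"] k_pos by (simp add: Pi_iff)

lemma coord0_zero: "coord0 \<zero>\<^bsub>S\<^esub> = \<zero>"
  using coord0_comb[of "\<lambda>i. \<zero>"] by (simp add: comb_def)

lemma coord0_finsum:
  assumes "finite A" and "c \<in> A \<rightarrow> carrier R" and "g \<in> A \<rightarrow> carrier S"
  shows "coord0 (\<Oplus>\<^bsub>S\<^esub>i\<in>A. h (c i) \<otimes>\<^bsub>S\<^esub> g i) = (\<Oplus>i\<in>A. c i \<otimes> coord0 (g i))"
  using assms
proof (induction A rule: finite_induct)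
  case empty
  show ?case by (simp add: coord0_zero)
next
  case (insert a A)
  have "coord0 (\<Oplus>\<^bsub>S\<^esub>i\<in>insert a A. h (c i) \<otimes>\<^bsub>S\<^esub> g i) =
      coord0 (h (c a) \<otimes>\<^bsub>S\<^esub> g a \<oplus>\<^bsub>S\<^esub> (\<Oplus>\<^bsub>S\<^esub>i\<in>A. h (c i) \<otimes>\<^bsub>S\<^esub> g i))"
    using insert by (subst S.finsum_insert) (auto simp: Pi_iff)
  also have "\<dots> = c a \<otimes> coord0 (g a) \<oplus> (\<Oplus>i\<in>A. c i \<otimes> coord0 (g i))"
    using insert by (subst coord0_linear) (auto simp: Pi_iff intro!: S.finsum_closed)
  also have "\<dots> = (\<Oplus>i\<in>insert a A. c i \<otimes> coord0 (g i))"
    using insert by (subst R.finsum_insert) (auto simp: Pi_iff)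
  finally show ?case .
qed

text \<open>Expanding the k-th power of \<open>\<alpha>\<close> gives coefficients \<open>c\<close>.
  Multiplying that relation by the n-th power and applying \<open>coord0\<close> yields the
  recurrence. The period equals the order of \<open>\<alpha>\<close>.\<close>

lemma ex_lin_rec_primitive:
  "\<exists>c a. lin_rec R k c a \<and> least_period a = card (carrier S) - 1"
proof -
  obtain c where c: "c \<in> {..<k} \<rightarrow> carrier R" "\<alpha> [^]\<^bsub>S\<^esub> k = comb k c"
    using comb_surj[of "\<alpha> [^]\<^bsub>S\<^esub> k"] by auto
  \<comment> \<open>Otherwise one factor \<open>\<alpha>\<close> cancels and the power with exponent
    k - 1 lies in the span of the lower ones.\<close>
  have c0: "c 0 \<noteq> \<zero>"
  proof
    assume "c 0 = \<zero>"
    obtain l where l: "k = Suc l" using k_pos by (metis Suc_le_D One_nat_def)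
    have tail: "(\<lambda>i. c (Suc i)) \<in> {..<l} \<rightarrow> carrier R" using c l by auto
    have "\<alpha> \<otimes>\<^bsub>S\<^esub> \<alpha> [^]\<^bsub>S\<^esub> l = comb (Suc l) c"
      using c(2) S.nat_pow_Suc2[of \<alpha> l] by (simp add: l)
    also have "\<dots> = comb (Suc l) (case_nat \<zero> (\<lambda>i. c (Suc i)))"
      using c \<open>c 0 = \<zero>\<close> by (intro comb_cong) (auto simp: l split: nat.split)
    also have "\<dots> = \<alpha> \<otimes>\<^bsub>S\<^esub> comb l (\<lambda>i. c (Suc i))"
      using comb_shift[OF tail] by simp
    finally have "\<alpha> [^]\<^bsub>S\<^esub> l = comb l (\<lambda>i. c (Suc i))"
      using tail alpha_nonzero S.m_lcancel[of \<alpha>] by simp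
    then have "\<alpha> [^]\<^bsub>S\<^esub> l \<in> span l" using tail by (auto simp: span_def)
    then show False using pow_notin_span[of l] by (simp add: l)
  qed
  define a where "a n = coord0 (\<alpha> [^]\<^bsub>S\<^esub> n)" for n :: nat
  have "lin_rec R k c a"
    unfolding lin_rec_def
  proof (intro conjI allI impI)
    show "a n \<in> carrier R" for n by (simp add: a_def)
    show "c i \<in> carrier R" if "i < k" for i using c that by auto
    show "c 0 \<in> Units R" using c c0 k_pos by (auto simp: R.field_Units)
    show "a (n + k) = (\<Oplus>i\<in>{..<k}. c i \<otimes> a (n + i))" for n
    proof -
      have "\<alpha> [^]\<^bsub>S\<^esub> (n + k) = \<alpha> [^]\<^bsub>S\<^esub> n \<otimes>\<^bsub>S\<^esub> comb k c"
        using c(2) S.nat_pow_mult[of \<alpha> n k] by simp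
      also have "\<dots> = (\<Oplus>\<^bsub>S\<^esub>i\<in>{..<k}. \<alpha> [^]\<^bsub>S\<^esub> n \<otimes>\<^bsub>S\<^esub> (h (c i) \<otimes>\<^bsub>S\<^esub> \<alpha> [^]\<^bsub>S\<^esub> i))"
        unfolding comb_def using c by (intro S.finsum_rdistr) (auto simp: Pi_iff)
      also have "\<dots> = (\<Oplus>\<^bsub>S\<^esub>i\<in>{..<k}. h (c i) \<otimes>\<^bsub>S\<^esub> \<alpha> [^]\<^bsub>S\<^esub> (n + i))"
      proof (rule S.finsum_cong')
        fix i assume "i \<in> {..<k}"
        then have "h (c i) \<in> carrier S" using c by (auto simp: Pi_iff)
        then show "\<alpha> [^]\<^bsub>S\<^esub> n \<otimes>\<^bsub>S\<^esub> (h (c i) \<otimes>\<^bsub>S\<^esub> \<alpha> [^]\<^bsub>S\<^esub> i) =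
            h (c i) \<otimes>\<^bsub>S\<^esub> \<alpha> [^]\<^bsub>S\<^esub> (n + i)"
          by (simp add: S.nat_pow_mult[symmetric] S.m_lcomm)
      qed (use c in \<open>auto simp: Pi_iff\<close>)
      finally show ?thesis
        unfolding a_def using c coord0_finsum[of "{..<k}" c "\<lambda>i. \<alpha> [^]\<^bsub>S\<^esub> (n + i)"] by simp
    qed
  qed
  moreover have "least_period a = card (carrier S) - 1"
    unfolding least_period_def
  proof (rule Least_equality)
    note fin = finite_ext
    have "card (carrier S) \<ge> 2" using S.finite_field_card_ge_2[OF fin] .
    have card: "card (carrier S - {\<zero>\<^bsub>S\<^esub>}) = card (carrier S) - 1"
      by (simp add: card_Diff_singleton)
    have one: "\<alpha> [^]\<^bsub>S\<^esub> (card (carrier S) - 1) = \<one>\<^bsub>S\<^esub>"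
      using S.units_power_order_eq_one[of \<alpha>] fin alpha_nonzero card by (simp add: S.field_Units)
    show "0 < card (carrier S) - 1 \<and> (\<forall>n. a (n + (card (carrier S) - 1)) = a n)"
    proof (intro conjI allI)
      show "0 < card (carrier S) - 1" using \<open>card (carrier S) \<ge> 2\<close> by simp
      show "a (n + (card (carrier S) - 1)) = a n" for n
        unfolding a_def using one S.nat_pow_mult[OF alpha]
        by (metis S.nat_pow_closed S.r_one alpha)
    qed
  next
    fix m :: nat assume "0 < m \<and> (\<forall>n. a (n + m) = a n)"
    then have m: "0 < m" "\<And>n. a (n + m) = a n" by auto
    have pow_m: "\<alpha> [^]\<^bsub>S\<^esub> m = \<one>\<^bsub>S\<^esub>"
    proof (rule ccontr)
      \<comment> \<open>Some power of \<open>\<alpha>\<close> with exponent \<open>n\<close> inverts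
        \<open>\<beta>\<close>. For this \<open>n\<close> the functional gives
        \<open>a (n + m) = \<one> \<oplus> a n\<close>, so \<open>m\<close> is not a period.\<close>
      define \<beta> where "\<beta> = \<alpha> [^]\<^bsub>S\<^esub> m \<ominus>\<^bsub>S\<^esub> \<one>\<^bsub>S\<^esub>"
      assume "\<alpha> [^]\<^bsub>S\<^esub> m \<noteq> \<one>\<^bsub>S\<^esub>"
      then have \<beta>: "\<beta> \<in> Units S" by (simp add: \<beta>_def S.field_Units)
      then have "inv\<^bsub>S\<^esub> \<beta> \<in> carrier S - {\<zero>\<^bsub>S\<^esub>}"
        using S.Units_inv_Units S.field_Units by blast
      then obtain n :: nat where n: "inv\<^bsub>S\<^esub> \<beta> = \<alpha> [^]\<^bsub>S\<^esub> n" unfolding generator by auto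
      then have "\<alpha> [^]\<^bsub>S\<^esub> n \<otimes>\<^bsub>S\<^esub> \<beta> = \<one>\<^bsub>S\<^esub>" using \<beta> by (metis S.Units_l_inv)
      moreover have "\<alpha> [^]\<^bsub>S\<^esub> m = \<beta> \<oplus>\<^bsub>S\<^esub> \<one>\<^bsub>S\<^esub>"
        by (simp add: \<beta>_def a_minus_def S.a_assoc S.l_neg)
      ultimately have "\<alpha> [^]\<^bsub>S\<^esub> (n + m) = h \<one> \<otimes>\<^bsub>S\<^esub> \<one>\<^bsub>S\<^esub> \<oplus>\<^bsub>S\<^esub> \<alpha> [^]\<^bsub>S\<^esub> n"
        using \<beta> S.Units_closed by (simp add: S.nat_pow_mult[symmetric] S.r_distr)
      then have "a (n + m) = \<one> \<oplus> a n"
        using coord0_linear[of "\<one>\<^bsub>S\<^esub>" "\<alpha> [^]\<^bsub>S\<^esub> n" \<one>] by (simp add: a_def coord0_one)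
      then have "a n = \<one> \<oplus> a n" using m(2) by simp
      moreover have "a n \<in> carrier R" by (simp add: a_def)
      ultimately show False using R.one_not_zero by (metis R.add.r_cancel_one' R.one_closed)
    qed
    \<comment> \<open>Exponents may be reduced modulo \<open>m\<close>, so at most \<open>m\<close>
      powers exhaust the nonzero elements.\<close>
    have "carrier S - {\<zero>\<^bsub>S\<^esub>} \<subseteq> (\<lambda>i. \<alpha> [^]\<^bsub>S\<^esub> i) ` {..<m}"
    proof
      fix x assume "x \<in> carrier S - {\<zero>\<^bsub>S\<^esub>}"
      then obtain i :: nat where "x = \<alpha> [^]\<^bsub>S\<^esub> i" unfolding generator by auto
      also have "\<dots> = \<alpha> [^]\<^bsub>S\<^esub> (m * (i div m) + i mod m)" by simp
      also have "\<dots> = \<alpha> [^]\<^bsub>S\<^esub> (i mod m)"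
        using pow_m S.nat_pow_mult[OF alpha] S.nat_pow_pow[OF alpha]
        by (metis S.l_one S.nat_pow_closed S.nat_pow_one alpha)
      finally show "x \<in> (\<lambda>i. \<alpha> [^]\<^bsub>S\<^esub> i) ` {..<m}" using m(1) by auto
    qed
    then have "card (carrier S - {\<zero>\<^bsub>S\<^esub>}) \<le> card {..<m}"
      by (rule surj_card_le[rotated]) simp
    then show "card (carrier S) - 1 \<le> m"
      by (simp add: card_Diff_singleton_if split: if_splits)
  qed
  ultimately show ?thesis by blast
qed

end

text \<open>The extension is the fixed field of the N-th power map in an algebraic closure, and
  \<open>\<alpha>\<close> exists because the multiplicative group of a finite field is
  cyclic.\<close>

lemma (in field) ex_lin_rec_max_period:
  assumes fin: "finite (carrier R)" and k: "k \<ge> 1"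
  shows "\<exists>c a. lin_rec R k c a \<and> least_period a = card (carrier R) ^ k - 1"
proof -
  obtain L :: "(('a list \<times> nat) multiset \<Rightarrow> 'a) ring"
    where closure: "algebraic_closure L (indexed_const ` carrier R)"
      and hom: "indexed_const \<in> ring_hom R L"
    by (rule exists_closure)
  interpret L: algebraic_closure L "indexed_const ` carrier R" by (rule closure)
  let ?N = "card (carrier R) ^ k"
  define K where "K = {x \<in> carrier L. x [^]\<^bsub>L\<^esub> ?N = x}"
  define M where "M = L\<lparr>carrier := K\<rparr>"
  \<comment> \<open>The embedding is injective, so the exponent \<open>?N\<close> is also the right
    one for the embedded copy of the base field.\<close>
  have card_base: "card (indexed_const ` carrier R) = card (carrier R)"
    using indexed_const_inj_on by (rule card_image)
  have K: "subfield K L" "indexed_const ` carrier R \<subseteq> K" "card K = ?N"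
    using L.fixed_points_of_frobenius[of ?N k] fin k unfolding K_def card_base by auto
  interpret M: field M unfolding M_def using L.subfield_iff(2)[OF K(1)] .
  have "indexed_const \<in> ring_hom R M"
    using hom K(2) by (auto simp: ring_hom_def M_def)
  then interpret emb: ring_hom_ring R M indexed_const
    by (intro ring_hom_ringI2 ring_axioms M.ring_axioms)
  have "card (carrier M) = ?N" using K(3) by (simp add: M_def)
  moreover have "finite (carrier M)"
    using K(3) finite_field_card_ge_2[OF fin] by (intro card_ge_0_finite) (simp add: M_def)
  then obtain \<alpha> where "\<alpha> \<in> carrier M"
    and "carrier M - {\<zero>\<^bsub>M\<^esub>} = range (\<lambda>i::nat. \<alpha> [^]\<^bsub>M\<^esub> i)"
    using M.finite_field_mult_group_has_gen
    by (auto simp: Multiplicative_Group.carrier_mult_of Multiplicative_Group.nat_pow_mult_of full_SetCompr_eq)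
  ultimately have "primitive_extension R M indexed_const \<alpha> k"
    using fin k by unfold_locales auto
  then show ?thesis
    using primitive_extension.ex_lin_rec_primitive \<open>card (carrier M) = ?N\<close> by metis
qed

theorem theorem4p6:
  fixes Fs :: "('a ring) list" and k :: nat
  assumes "length Fs \<ge> 1"
    and "\<forall>F \<in> set Fs. field F \<and> finite (carrier F)"
    and "k \<ge> 1"
  shows "(\<exists>c a. lin_rec (RDirProd_list Fs) k c a \<and>
            least_period a = card (carrier (RDirProd_list Fs)) ^ k - 1)
         \<longleftrightarrow> length Fs = 1"
proof
  assume "\<exists>c a. lin_rec (RDirProd_list Fs) k c a \<and>
            least_period a = card (carrier (RDirProd_list Fs)) ^ k - 1"
  then obtain c a where ca: "lin_rec (RDirProd_list Fs) k c a"
    "least_period a = card (carrier (RDirProd_list Fs)) ^ k - 1" by blast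
  show "length Fs = 1"
  proof (rule ccontr)
    assume "length Fs \<noteq> 1"
    then have "length Fs \<ge> 2" using assms(1) by simp
    then have "least_period a < card (carrier (RDirProd_list Fs)) ^ k - 1"
      using least_period_RDirProd_list_less[OF _ _ assms(3) ca(1)] assms(2) by blast
    then show False using ca(2) by simp
  qed
next
  assume "length Fs = 1"
  then obtain F where Fs: "Fs = [F]" by (auto simp: length_Suc_conv)
  have F: "field F" "finite (carrier F)" using assms(2) by (auto simp: Fs)
  obtain c a where ca: "lin_rec F k c a" "least_period a = card (carrier F) ^ k - 1"
    using field.ex_lin_rec_max_period[OF F assms(3)] by blast
  \<comment> \<open>Elements of a one-factor product are singleton lists. The sequence over
    \<open>F\<close> is transported by sending \<open>x\<close> to \<open>[x]\<close>, which is
    injective and so keeps the least period.\<close>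
  have ring: "ring (RDirProd_list [F])"
    using F by (intro RDirProd_list_is_ring) (simp add: field.is_ring)
  have "(\<lambda>x. [x]) \<in> ring_hom F (RDirProd_list [F])"
    using RDirProd_list_iso3[of F] by (simp add: ring_iso_def)
  then have "ring_hom_ring F (RDirProd_list [F]) (\<lambda>x. [x])"
    using F ring by (intro ring_hom_ringI2) (auto simp: field.is_ring)
  then have "lin_rec (RDirProd_list Fs) k (\<lambda>i. [c i]) (\<lambda>n. [a n])"
    unfolding Fs using ca(1) by (rule ring_hom_ring.lin_rec_hom)
  moreover have "least_period (\<lambda>n. [a n]) = least_period a"
    by (simp add: least_period_def)
  moreover have "card (carrier (RDirProd_list Fs)) = card (carrier F)"
    by (simp add: Fs card_RDirProd_list_Cons)
  ultimately show "\<exists>c a. lin_rec (RDirProd_list Fs) k c a \<and>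
      least_period a = card (carrier (RDirProd_list Fs)) ^ k - 1"
    using ca(2) by metis
qed

end
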